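(* Let $n \ge 1$. Given a binary string $\alpha$ of length $n$, one can determine whether $\alpha \in \mathbf{A}(n)$ in $O(n)$ time using $O(n)$ space.
   Context: Binary strings are compared lexicographically with $0<1$: $\alpha<\beta$ if $\alpha$ is a proper prefix of $\beta$, or if $a_i<b_i$ at the first index $i$ where they differ. For $\alpha=a_1\cdots a_n$, $\alpha^R=a_n\cdots a_1$ is its reversal. The necklace class $[\alpha]$ is the set of rotations of $\alpha$; $\alpha$ is a necklace if it is the lexicographically smallest string in $[\alpha]$. $\alpha$ is a bracelet if it is the lexicographically smallest string in $[\alpha]\cup[\alpha^R]$. A necklace $\alpha$ is symmetric if $\alpha^R\in[\alpha]$; otherwise it is asymmetric. $\mathbf{A}(n)$ denotes the set of asymmetric bracelets of length $n$, i.e. length-$n$ bracelets that are not symmetric. *)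

theory Defs
  imports Complex_Main "HOL-Library.List_Lexorder" "HOL-Library.Landau_Symbols"
begin

section \<open>Binary necklaces and bracelets\<close>

text \<open>
  A binary string is a \<^typ>\<open>bool list\<close>, with \<^const>\<open>False\<close> for 0 and \<^const>\<open>True\<close> for 1.  The order on
  strings is the one of \<^theory>\<open>HOL-Library.List_Lexorder\<close>, in which a proper prefix is smaller.
\<close>

definition necklace_class :: "bool list \<Rightarrow> bool list set" where
  "necklace_class \<alpha> = {rotate k \<alpha> | k. True}"

definition is_necklace :: "bool list \<Rightarrow> bool" where
  "is_necklace \<alpha> \<longleftrightarrow> (\<forall>\<beta>\<in>necklace_class \<alpha>. \<alpha> \<le> \<beta>)"

definition is_bracelet :: "bool list \<Rightarrow> bool" where
  "is_bracelet \<alpha> \<longleftrightarrow> (\<forall>\<beta>\<in>necklace_class \<alpha> \<union> necklace_class (rev \<alpha>). \<alpha> \<le> \<beta>)"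

definition is_symmetric :: "bool list \<Rightarrow> bool" where
  "is_symmetric \<alpha> \<longleftrightarrow> rev \<alpha> \<in> necklace_class \<alpha>"

text \<open>
  Symmetry is a property of necklaces; it is only used here for bracelets, which are necklaces.
\<close>

lemma is_bracelet_imp_is_necklace: "is_bracelet \<alpha> \<Longrightarrow> is_necklace \<alpha>"
  by (auto simp: is_bracelet_def is_necklace_def)

definition asymmetric_bracelets :: "nat \<Rightarrow> bool list set" where
  "asymmetric_bracelets n = {\<alpha>. length \<alpha> = n \<and> is_bracelet \<alpha> \<and> \<not> is_symmetric \<alpha>}"


section \<open>Random access machines\<close>

text \<open>
  The machine has registers, addressed only by constants of the program (so a program uses finitely
  many of them), and a memory, addressed indirectly through registers.  Both hold natural numbers.
  Every instruction costs one unit of time.  There is no multiplication, division or bitwise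
  operation.  Execution halts when the program counter leaves the program.
\<close>

datatype instr =
    SetConst nat nat
  | Move nat nat
  | Add nat nat nat
  | Sub nat nat nat
  | Load nat nat
  | Store nat nat
  | Jump nat
  | JumpEq nat nat nat
  | JumpLess nat nat nat

type_synonym program = "instr list"

record config =
  pc :: nat
  reg :: "nat \<Rightarrow> nat"
  mem :: "nat \<Rightarrow> nat"

text \<open>
  The target register comes first, \<open>Store r s\<close> writes register \<open>s\<close> to the address held in register
  \<open>r\<close>, and \<open>Sub\<close> is truncated subtraction.
\<close>

fun exec_instr :: "instr \<Rightarrow> config \<Rightarrow> config" where
  "exec_instr (SetConst r c) s = s\<lparr>pc := pc s + 1, reg := (reg s)(r := c)\<rparr>"
| "exec_instr (Move r r1) s = s\<lparr>pc := pc s + 1, reg := (reg s)(r := reg s r1)\<rparr>"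
| "exec_instr (Add r r1 r2) s = s\<lparr>pc := pc s + 1, reg := (reg s)(r := reg s r1 + reg s r2)\<rparr>"
| "exec_instr (Sub r r1 r2) s = s\<lparr>pc := pc s + 1, reg := (reg s)(r := reg s r1 - reg s r2)\<rparr>"
| "exec_instr (Load r r1) s = s\<lparr>pc := pc s + 1, reg := (reg s)(r := mem s (reg s r1))\<rparr>"
| "exec_instr (Store r r1) s = s\<lparr>pc := pc s + 1, mem := (mem s)(reg s r := reg s r1)\<rparr>"
| "exec_instr (Jump l) s = s\<lparr>pc := l\<rparr>"
| "exec_instr (JumpEq r1 r2 l) s = s\<lparr>pc := (if reg s r1 = reg s r2 then l else pc s + 1)\<rparr>"
| "exec_instr (JumpLess r1 r2 l) s = s\<lparr>pc := (if reg s r1 < reg s r2 then l else pc s + 1)\<rparr>"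

definition halted :: "program \<Rightarrow> config \<Rightarrow> bool" where
  "halted P s \<longleftrightarrow> length P \<le> pc s"

definition step :: "program \<Rightarrow> config \<Rightarrow> config" where
  "step P s = (if halted P s then s else exec_instr (P ! pc s) s)"

text \<open>
  Initially register 0 holds the length of the input and the memory cells from address 0 on hold
  its bits; everything else is 0.  The output is the final content of register 0.
\<close>

definition init_config :: "bool list \<Rightarrow> config" where
  "init_config \<alpha> =
     \<lparr>pc = 0,
      reg = (\<lambda>_. 0)(0 := length \<alpha>),
      mem = (\<lambda>i. if i < length \<alpha> then of_bool (\<alpha> ! i) else 0)\<rparr>"

definition config_at :: "program \<Rightarrow> bool list \<Rightarrow> nat \<Rightarrow> config" where
  "config_at P \<alpha> t = (step P ^^ t) (init_config \<alpha>)"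

definition halts :: "program \<Rightarrow> bool list \<Rightarrow> bool" where
  "halts P \<alpha> \<longleftrightarrow> (\<exists>t. halted P (config_at P \<alpha> t))"

text \<open>\<open>run_time\<close>, \<open>run_output\<close> and \<open>run_space\<close> are meaningful only if \<open>halts P \<alpha>\<close>.\<close>

definition run_time :: "program \<Rightarrow> bool list \<Rightarrow> nat" where
  "run_time P \<alpha> = (LEAST t. halted P (config_at P \<alpha> t))"

definition run_output :: "program \<Rightarrow> bool list \<Rightarrow> nat" where
  "run_output P \<alpha> = reg (config_at P \<alpha> (run_time P \<alpha>)) 0"

fun instr_registers :: "instr \<Rightarrow> nat set" where
  "instr_registers (SetConst r c) = {r}"
| "instr_registers (Move r r1) = {r, r1}"
| "instr_registers (Add r r1 r2) = {r, r1, r2}"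
| "instr_registers (Sub r r1 r2) = {r, r1, r2}"
| "instr_registers (Load r r1) = {r, r1}"
| "instr_registers (Store r r1) = {r, r1}"
| "instr_registers (Jump l) = {}"
| "instr_registers (JumpEq r1 r2 l) = {r1, r2}"
| "instr_registers (JumpLess r1 r2 l) = {r1, r2}"

definition registers :: "program \<Rightarrow> nat set" where
  "registers P = insert 0 (\<Union>(instr_registers ` set P))"

fun instr_addresses :: "instr \<Rightarrow> config \<Rightarrow> nat set" where
  "instr_addresses (Load r r1) s = {reg s r1}"
| "instr_addresses (Store r r1) s = {reg s r}"
| "instr_addresses _ s = {}"

definition accessed_addresses :: "program \<Rightarrow> bool list \<Rightarrow> nat set" where
  "accessed_addresses P \<alpha> =
     (\<Union>t<run_time P \<alpha>. instr_addresses (P ! pc (config_at P \<alpha> t)) (config_at P \<alpha> t))"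

text \<open>
  Space is the number of registers plus the length of the shortest initial segment of the memory
  that contains the input and every cell accessed.  The extent is used rather than the
  number of distinct cells accessed because the latter is trivially bounded by the running time.
\<close>

definition run_space :: "program \<Rightarrow> bool list \<Rightarrow> nat" where
  "run_space P \<alpha> =
     card (registers P) + Max (insert (length \<alpha>) (Suc ` accessed_addresses P \<alpha>))"

definition worst_case :: "(bool list \<Rightarrow> nat) \<Rightarrow> nat \<Rightarrow> nat" where
  "worst_case f n = Max (f ` {\<alpha>. length \<alpha> = n})"

text \<open>
  Unit cost per instruction and per cell is only realistic if cells hold words of \<open>O(log n)\<close> bits,
  that is, numbers polynomially bounded in the input length \<open>n\<close>.
\<close>

definition logarithmic_word_size :: "program \<Rightarrow> bool" where
  "logarithmic_word_size P \<longleftrightarrow>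
     (\<exists>c. \<forall>\<alpha>. \<alpha> \<noteq> [] \<longrightarrow> (\<forall>t i.
        reg (config_at P \<alpha> t) i \<le> (length \<alpha> + 1) ^ c \<and>
        mem (config_at P \<alpha> t) i \<le> (length \<alpha> + 1) ^ c))"

end

theory Submission
  imports Defs
begin

text \<open>
  A string \<open>\<alpha>\<close> is an asymmetric bracelet iff \<open>\<alpha> \<le> \<rho>\<close> for every rotation \<open>\<rho>\<close> of \<open>\<alpha>\<close> and \<open>\<alpha> < \<rho>\<close> for
  every rotation \<open>\<rho>\<close> of its reversal.  Both families of rotations are scanned in the same way.  Let
  \<open>\<beta>\<close> be \<open>\<alpha>\<close> or its reversal, and suppose that \<open>\<alpha>\<close> agrees with the rotation of \<open>\<beta>\<close> by \<open>j\<close> on the first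
  \<open>k\<close> letters and is smaller at the next one.  Then for every \<open>l \<le> k\<close> the rotation of \<open>\<alpha>\<close> by \<open>l\<close> is
  smaller than the rotation of \<open>\<beta>\<close> by \<open>j + l\<close>.  As the former is already known to be at least
  \<open>\<alpha>\<close>, the scan may continue at \<open>j + k + 1\<close>, with \<open>k = 0\<close>.  If \<open>\<alpha>\<close> is larger at the first mismatch,
  it is rejected.  Every comparison increases \<open>j + k\<close> by one, so that a scan makes at most \<open>2n\<close>
  comparisons.
\<close>

section \<open>Comparing a string with rotations\<close>

lemma list_less_first_mismatch:
  fixes xs ys :: "'a::linorder list"
  assumes "length xs = length ys" "k < length xs" "\<And>i. i < k \<Longrightarrow> xs ! i = ys ! i" "xs ! k < ys ! k"
  shows "xs < ys"
  using assms
proof (induction xs ys arbitrary: k rule: list_induct2')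
  case (4 x xs y ys)
  show ?case
  proof (cases k)
    case 0
    with "4.prems" show ?thesis by simp
  next
    case (Suc k')
    have "x = y"
      using "4.prems"(3)[of 0] Suc by simp
    moreover have "xs < ys"
    proof (rule "4.IH"[of k'])
      show "xs ! i = ys ! i" if "i < k'" for i
        using "4.prems"(3)[of "Suc i"] Suc that by simp
    qed (use "4.prems" Suc in auto)
    ultimately show ?thesis by simp
  qed
qed auto

text \<open>Dropping the first \<open>l\<close> common letters moves the first mismatch to
  \<open>k - l\<close>; since \<open>l\<close> is at most \<open>k\<close>, nothing wraps around
  before it.\<close>

lemma rotate_less_rotate:
  fixes xs ys :: "'a::linorder list"
  assumes "length xs = length ys" "k < length xs"
    and eq: "\<And>i. i < k \<Longrightarrow> xs ! i = rotate j ys ! i"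
    and less: "xs ! k < rotate j ys ! k" and "l \<le> k"
  shows "rotate l xs < rotate (j + l) ys"
proof (rule list_less_first_mismatch)
  have nth: "rotate l xs ! i = xs ! (l + i) \<and> rotate (j + l) ys ! i = rotate j ys ! (l + i)"
    if "i \<le> k - l" for i
    using that assms(1,2,5) by (simp add: nth_rotate add.assoc)
  show "k - l < length (rotate l xs)"
    using assms(2) by simp
  show "rotate l xs ! i = rotate (j + l) ys ! i" if "i < k - l" for i
    using nth[of i] eq[of "l + i"] that by simp
  show "rotate l xs ! (k - l) < rotate (j + l) ys ! (k - l)"
    using nth[of "k - l"] less assms(5) by simp
qed (use assms(1) in simp)

lemma all_rotate_iff:
  assumes "\<alpha> \<noteq> []"
  shows "(\<forall>i<length \<alpha>. P (rotate i \<alpha>)) \<longleftrightarrow> (\<forall>i. P (rotate i \<alpha>))"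
  using assms by (metis length_greater_0_conv mod_less_divisor rotate_conv_mod)

lemma rotate_eq_iff_ex:
  fixes xs ys :: "'a list"
  shows "(\<exists>k. ys = rotate k xs) \<longleftrightarrow> (\<exists>k. xs = rotate k ys)"
proof -
  have "\<exists>k. xs = rotate k ys" if "ys = rotate l xs" for l and xs ys :: "'a list"
  proof (cases "xs = []")
    case False
    have "rotate (length xs - l mod length xs) ys
        = rotate (length xs - l mod length xs) (rotate (l mod length xs) xs)"
      using that rotate_conv_mod by metis
    also have "\<dots> = rotate (length xs) xs"
      using False by (simp add: rotate_rotate less_imp_le)
    finally show ?thesis by (metis rotate_id mod_self)
  qed (use that in auto)
  then show ?thesis by blast
qed

lemma asymmetric_bracelets_iff:
  "\<alpha> \<in> asymmetric_bracelets (length \<alpha>) \<longleftrightarrow>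
     (\<forall>i. \<alpha> \<le> rotate i \<alpha>) \<and> (\<forall>i. \<alpha> < rotate i (rev \<alpha>))"
proof -
  have "is_symmetric \<alpha> \<longleftrightarrow> (\<exists>i. \<alpha> = rotate i (rev \<alpha>))"
    unfolding is_symmetric_def necklace_class_def using rotate_eq_iff_ex[of "rev \<alpha>" \<alpha>] by simp
  moreover have "is_bracelet \<alpha> \<longleftrightarrow> (\<forall>i. \<alpha> \<le> rotate i \<alpha>) \<and> (\<forall>i. \<alpha> \<le> rotate i (rev \<alpha>))"
    unfolding is_bracelet_def necklace_class_def by blast
  ultimately show ?thesis
    unfolding asymmetric_bracelets_def by (auto simp: less_le)
qed

section \<open>Loop states of the scan\<close>

text \<open>The parameter \<open>m\<close> is 0 while rotations of \<open>\<alpha>\<close> are scanned and 1 for those of its reversal.\<close>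

definition scanned :: "bool list \<Rightarrow> nat \<Rightarrow> bool list" where
  "scanned \<alpha> m = (if m = 0 then \<alpha> else rev \<alpha>)"

text \<open>Phase 0 starts at \<open>j = 1\<close>, past the trivial rotation: a positive
  \<open>j\<close> is what lets the inductions on rotations of \<open>\<alpha>\<close> descend. In
  phase 1 the result of phase 0 is carried along.\<close>

definition verified :: "bool list \<Rightarrow> nat \<Rightarrow> nat \<Rightarrow> bool" where
  "verified \<alpha> m j \<longleftrightarrow>
     (if m = 0 then 0 < j \<and> (\<forall>i<j. \<alpha> \<le> rotate i \<alpha>)
      else (\<forall>i. \<alpha> \<le> rotate i \<alpha>) \<and> (\<forall>i<j. \<alpha> < rotate i (rev \<alpha>)))"

definition agree :: "bool list \<Rightarrow> nat \<Rightarrow> nat \<Rightarrow> nat \<Rightarrow> bool" where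
  "agree \<alpha> m j k \<longleftrightarrow> (\<forall>i<k. \<alpha> ! i = rotate j (scanned \<alpha> m) ! i)"

lemma length_scanned [simp]: "length (scanned \<alpha> m) = length \<alpha>"
  by (simp add: scanned_def)

lemma agree_0 [simp]: "agree \<alpha> m j 0"
  by (simp add: agree_def)

lemma agree_Suc:
  "agree \<alpha> m j (Suc k) \<longleftrightarrow> agree \<alpha> m j k \<and> \<alpha> ! k = rotate j (scanned \<alpha> m) ! k"
  by (auto simp: agree_def less_Suc_eq)

lemma verified_extend:
  assumes "verified \<alpha> m j" "agree \<alpha> m j k" "k < length \<alpha>" "\<alpha> ! k < rotate j (scanned \<alpha> m) ! k"
  shows "verified \<alpha> m (Suc (j + k))"
proof -
  have rotated: "rotate l \<alpha> < rotate (j + l) (scanned \<alpha> m)" if "l \<le> k" for l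
    by (rule rotate_less_rotate) (use assms that in \<open>auto simp: agree_def\<close>)
  show ?thesis
  proof (cases "m = 0")
    case True
    have j: "0 < j" "\<And>i. i < j \<Longrightarrow> \<alpha> \<le> rotate i \<alpha>"
      using assms(1) True by (auto simp: verified_def)
    have "\<alpha> \<le> rotate i \<alpha>" if "i < Suc (j + k)" for i
      using that
    proof (induction i rule: less_induct)
      case (less i)
      show ?case
      proof (cases "i < j")
        case False
        \<comment> \<open>As \<open>0 < j\<close>, the rotation by \<open>l\<close> comes earlier
          and is covered by the induction hypothesis.\<close>
        define l where "l = i - j"
        have l: "i = j + l" "l \<le> k" "l < i"
          using False less.prems j(1) by (auto simp: l_def)
        have "\<alpha> \<le> rotate l \<alpha>"
          using less.IH[of l] less.prems l by simp
        also have "\<dots> < rotate i \<alpha>"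
          using rotated[of l] l True by (simp add: scanned_def)
        finally show ?thesis by simp
      qed (use j in blast)
    qed
    then show ?thesis
      using True by (simp add: verified_def)
  next
    case False
    have j: "\<And>i. \<alpha> \<le> rotate i \<alpha>" "\<And>i. i < j \<Longrightarrow> \<alpha> < rotate i (rev \<alpha>)"
      using assms(1) False by (auto simp: verified_def)
    have "\<alpha> < rotate i (rev \<alpha>)" if "i < Suc (j + k)" for i
    proof (cases "i < j")
      case False
      have "\<alpha> \<le> rotate (i - j) \<alpha>"
        by (rule j(1))
      also have "\<dots> < rotate i (rev \<alpha>)"
        using rotated[of "i - j"] False that \<open>m \<noteq> 0\<close> by (simp add: scanned_def)
      finally show ?thesis .
    qed (use j in blast)
    then show ?thesis
      using False j(1) by (simp add: verified_def)
  qed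
qed

lemma not_asymmetric_if_larger:
  assumes "agree \<alpha> m j k" "k < length \<alpha>" "rotate j (scanned \<alpha> m) ! k < \<alpha> ! k"
  shows "\<alpha> \<notin> asymmetric_bracelets (length \<alpha>)"
proof -
  have "rotate j (scanned \<alpha> m) < \<alpha>"
    by (rule list_less_first_mismatch[of _ _ k]) (use assms in \<open>auto simp: agree_def\<close>)
  then show ?thesis
    unfolding asymmetric_bracelets_iff scanned_def by (metis leD less_asym)
qed

lemma agree_length:
  assumes "agree \<alpha> m j (length \<alpha>)"
  shows "rotate j (scanned \<alpha> m) = \<alpha>"
  using assms by (intro nth_equalityI) (auto simp: agree_def)

lemma not_asymmetric_if_equal:
  assumes "agree \<alpha> m j (length \<alpha>)" "m \<noteq> 0"
  shows "\<alpha> \<notin> asymmetric_bracelets (length \<alpha>)"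
  using agree_length[OF assms(1)] assms(2)
  unfolding asymmetric_bracelets_iff scanned_def by (metis less_irrefl)

lemma necklace_if_verified:
  assumes "verified \<alpha> 0 j" "\<alpha> \<noteq> []" "length \<alpha> \<le> j"
  shows "\<alpha> \<le> rotate i \<alpha>"
  using assms all_rotate_iff[of \<alpha> "\<lambda>\<beta>. \<alpha> \<le> \<beta>"] by (auto simp: verified_def)

text \<open>Full agreement means that rotating by \<open>j\<close> fixes \<open>\<alpha>\<close>, so
  every rotation reduces to one by less than \<open>j\<close>. Phase 0 may therefore stop
  early.\<close>

lemma necklace_if_period:
  assumes "verified \<alpha> 0 j" "agree \<alpha> 0 j (length \<alpha>)"
  shows "\<alpha> \<le> rotate i \<alpha>"
proof (induction i rule: less_induct)
  case (less i)
  show ?case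
  proof (cases "i < j")
    case False
    have "rotate i \<alpha> = rotate (i - j) (rotate j \<alpha>)"
      using False by (simp add: rotate_rotate)
    also have "rotate j \<alpha> = \<alpha>"
      using agree_length[OF assms(2)] by (simp add: scanned_def)
    finally show ?thesis
      using less.IH[of "i - j"] assms(1) False by (simp add: verified_def)
  qed (use assms(1) in \<open>simp add: verified_def\<close>)
qed

lemma asymmetric_if_verified:
  assumes "verified \<alpha> m j" "m \<noteq> 0" "\<alpha> \<noteq> []" "length \<alpha> \<le> j"
  shows "\<alpha> \<in> asymmetric_bracelets (length \<alpha>)"
  using assms all_rotate_iff[of "rev \<alpha>" "\<lambda>\<beta>. \<alpha> < \<beta>"]
  by (auto simp: verified_def asymmetric_bracelets_iff)


section \<open>Invariants and potentials of programs\<close>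

lemma config_at_0 [simp]: "config_at P \<alpha> 0 = init_config \<alpha>"
  by (simp add: config_at_def)

lemma config_at_Suc: "config_at P \<alpha> (Suc t) = step P (config_at P \<alpha> t)"
  by (simp add: config_at_def)

lemma config_at_invariant:
  assumes "I (init_config \<alpha>)" "\<And>s. I s \<Longrightarrow> \<not> halted P s \<Longrightarrow> I (step P s)"
  shows "I (config_at P \<alpha> t)"
proof (induction t)
  case (Suc t)
  then show ?case
    using assms(2) by (cases "halted P (config_at P \<alpha> t)") (auto simp: config_at_Suc step_def)
qed (use assms(1) in simp)

text \<open>Without a halt by then, \<open>t + \<Phi>\<close> would never increase, which fails one
  step after time \<open>\<Phi> (init_config \<alpha>)\<close>.\<close>

lemma halted_at_potential:
  fixes \<Phi> :: "config \<Rightarrow> nat"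
  assumes "I (init_config \<alpha>)"
    and "\<And>s. I s \<Longrightarrow> \<not> halted P s \<Longrightarrow> I (step P s) \<and> \<Phi> (step P s) < \<Phi> s"
  shows "\<exists>t\<le>\<Phi> (init_config \<alpha>). halted P (config_at P \<alpha> t)"
proof (rule ccontr)
  assume *: "\<not> ?thesis"
  have "t + \<Phi> (config_at P \<alpha> t) \<le> \<Phi> (init_config \<alpha>)" if "t \<le> Suc (\<Phi> (init_config \<alpha>))" for t
    using that
  proof (induction t)
    case (Suc t)
    have "I (config_at P \<alpha> t)"
      using assms config_at_invariant[of I] by blast
    with Suc * assms(2)[of "config_at P \<alpha> t"] show ?case
      by (fastforce simp: config_at_Suc)
  qed simp
  from this[of "Suc (\<Phi> (init_config \<alpha>))"] show False by simp
qed

lemma worst_case_le: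
  assumes "\<And>\<alpha>. length \<alpha> = n \<Longrightarrow> f \<alpha> \<le> b"
  shows "worst_case f n \<le> b"
proof -
  have "finite {\<alpha> :: bool list. length \<alpha> = n}"
    using finite_lists_length_eq[of "UNIV :: bool set" n] by simp
  \<comment> \<open>Nonemptiness is required for \<open>Max\<close> to be characterised.\<close>
  moreover have "replicate n False \<in> {\<alpha>. length \<alpha> = n}"
    by simp
  ultimately show ?thesis
    unfolding worst_case_def using assms by (subst Max_le_iff) blast+
qed

lemma worst_case_bigo:
  assumes "\<And>\<alpha>. \<alpha> \<noteq> [] \<Longrightarrow> f \<alpha> \<le> c * length \<alpha>"
  shows "(\<lambda>n. real (worst_case f n)) \<in> O(\<lambda>n. real n)"
proof (rule bigoI[of _ "real c"])
  have "worst_case f n \<le> c * n" if "0 < n" for n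
    using assms that by (intro worst_case_le) auto
  then have "real (worst_case f n) \<le> real c * real n" if "0 < n" for n
    using that by (metis of_nat_le_iff of_nat_mult)
  then show "\<forall>\<^sub>F n in sequentially. norm (real (worst_case f n)) \<le> real c * norm (real n)"
    by (intro eventually_sequentiallyI[of 1]) simp
qed


section \<open>The program\<close>

text \<open>
  Register 0 holds \<open>n\<close>, 1 holds \<open>j\<close>, 2 holds \<open>k\<close>, 3 is the position in \<open>\<alpha>\<close> of the \<open>k\<close>-th letter of
  the current rotation, 4 and 5 are the two letters compared, 6 is the constant 1, and 7 is the
  phase \<open>m\<close>.
\<close>

definition bracelet_program :: program where
  "bracelet_program =
    [SetConst 6 1,        \<comment> \<open>0\<close>
     SetConst 1 1,
     JumpLess 1 0 4,      \<comment> \<open>2: head of the scanning loop\<close>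
     Jump 22,
     JumpEq 2 0 21,
     Add 3 1 2,           \<comment> \<open>5\<close>
     JumpLess 3 0 8,
     Sub 3 3 0,
     JumpLess 7 6 11,
     Sub 3 0 3,
     Sub 3 3 6,           \<comment> \<open>10\<close>
     Load 4 2,
     Load 5 3,
     JumpEq 4 5 19,
     JumpLess 5 4 27,
     Add 1 1 2,           \<comment> \<open>15: \<open>\<alpha>\<close> is smaller\<close>
     Add 1 1 6,
     SetConst 2 0,
     Jump 2,
     Add 2 2 6,           \<comment> \<open>19: equal letters\<close>
     Jump 2,
     JumpEq 7 6 27,       \<comment> \<open>21: the rotation equals \<open>\<alpha>\<close>\<close>
     JumpEq 7 6 29,       \<comment> \<open>22: the phase is complete\<close>
     SetConst 7 1,
     SetConst 1 0,
     SetConst 2 0,        \<comment> \<open>25\<close>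
     Jump 2,
     SetConst 0 0,        \<comment> \<open>27: reject\<close>
     Jump 30,
     SetConst 0 1]        \<comment> \<open>29: accept\<close>"

definition scanning :: "bool list \<Rightarrow> (nat \<Rightarrow> nat) \<Rightarrow> bool" where
  "scanning \<alpha> r \<longleftrightarrow> r 0 = length \<alpha> \<and> r 6 = 1 \<and> r 7 \<le> 1 \<and> verified \<alpha> (r 7) (r 1) \<and>
     agree \<alpha> (r 7) (r 1) (r 2) \<and> r 1 + r 2 \<le> 2 * length \<alpha> \<and> r 2 \<le> length \<alpha>"

definition comparing :: "bool list \<Rightarrow> (nat \<Rightarrow> nat) \<Rightarrow> bool" where
  "comparing \<alpha> r \<longleftrightarrow> scanning \<alpha> r \<and> r 1 < length \<alpha> \<and> r 2 < length \<alpha>"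

abbreviation letter :: "bool list \<Rightarrow> (nat \<Rightarrow> nat) \<Rightarrow> bool" where
  "letter \<alpha> r \<equiv> rotate (r 1) (scanned \<alpha> (r 7)) ! r 2"

definition restarting :: "bool list \<Rightarrow> (nat \<Rightarrow> nat) \<Rightarrow> bool" where
  "restarting \<alpha> r \<longleftrightarrow> r 0 = length \<alpha> \<and> r 6 = 1 \<and> (\<forall>i. \<alpha> \<le> rotate i \<alpha>)"

text \<open>Entry \<open>p\<close> is the assertion that holds when the program counter is \<open>p\<close>.\<close>

definition annotations :: "bool list \<Rightarrow> ((nat \<Rightarrow> nat) \<Rightarrow> bool) list" where
  "annotations \<alpha> =
    [\<lambda>r. r = (\<lambda>_. 0)(0 := length \<alpha>),
     \<lambda>r. r = (\<lambda>_. 0)(0 := length \<alpha>, 6 := 1),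
     \<lambda>r. scanning \<alpha> r,
     \<lambda>r. scanning \<alpha> r \<and> length \<alpha> \<le> r 1,
     \<lambda>r. scanning \<alpha> r \<and> r 1 < length \<alpha>,
     \<lambda>r. comparing \<alpha> r,
     \<lambda>r. comparing \<alpha> r \<and> r 3 = r 1 + r 2,
     \<lambda>r. comparing \<alpha> r \<and> r 3 = r 1 + r 2 \<and> length \<alpha> \<le> r 3,
     \<lambda>r. comparing \<alpha> r \<and> r 3 = (r 1 + r 2) mod length \<alpha>,
     \<lambda>r. comparing \<alpha> r \<and> r 3 = (r 1 + r 2) mod length \<alpha> \<and> r 7 = 1,
     \<lambda>r. comparing \<alpha> r \<and> r 3 = length \<alpha> - (r 1 + r 2) mod length \<alpha> \<and> r 7 = 1,
     \<lambda>r. comparing \<alpha> r \<and> r 3 < length \<alpha> \<and> \<alpha> ! r 3 = letter \<alpha> r,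
     \<lambda>r. comparing \<alpha> r \<and> r 3 < length \<alpha> \<and> \<alpha> ! r 3 = letter \<alpha> r \<and> r 4 = of_bool (\<alpha> ! r 2),
     \<lambda>r. comparing \<alpha> r \<and> r 4 = of_bool (\<alpha> ! r 2) \<and> r 5 = of_bool (letter \<alpha> r),
     \<lambda>r. comparing \<alpha> r \<and> \<alpha> ! r 2 \<noteq> letter \<alpha> r \<and>
       r 4 = of_bool (\<alpha> ! r 2) \<and> r 5 = of_bool (letter \<alpha> r),
     \<lambda>r. comparing \<alpha> r \<and> \<alpha> ! r 2 < letter \<alpha> r,
     \<lambda>r. r 0 = length \<alpha> \<and> r 6 = 1 \<and> r 7 \<le> 1 \<and> verified \<alpha> (r 7) (Suc (r 1)) \<and>
       Suc (r 1) < 2 * length \<alpha>,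
     \<lambda>r. r 0 = length \<alpha> \<and> r 6 = 1 \<and> r 7 \<le> 1 \<and> verified \<alpha> (r 7) (r 1) \<and> r 1 < 2 * length \<alpha>,
     \<lambda>r. scanning \<alpha> r,
     \<lambda>r. comparing \<alpha> r \<and> agree \<alpha> (r 7) (r 1) (Suc (r 2)),
     \<lambda>r. scanning \<alpha> r,
     \<lambda>r. scanning \<alpha> r \<and> r 2 = length \<alpha>,
     \<lambda>r. r 0 = length \<alpha> \<and> r 6 = 1 \<and>
       (if r 7 = 1 then \<alpha> \<in> asymmetric_bracelets (length \<alpha>)
        else r 7 = 0 \<and> (\<forall>i. \<alpha> \<le> rotate i \<alpha>)),
     \<lambda>r. restarting \<alpha> r \<and> r 7 = 0,
     \<lambda>r. restarting \<alpha> r \<and> r 7 = 1,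
     \<lambda>r. restarting \<alpha> r \<and> r 7 = 1 \<and> r 1 = 0,
     \<lambda>r. restarting \<alpha> r \<and> r 7 = 1 \<and> r 1 = 0 \<and> r 2 = 0,
     \<lambda>r. \<alpha> \<notin> asymmetric_bracelets (length \<alpha>),
     \<lambda>r. \<alpha> \<notin> asymmetric_bracelets (length \<alpha>) \<and> r 0 = 0,
     \<lambda>r. \<alpha> \<in> asymmetric_bracelets (length \<alpha>),
     \<lambda>r. r 0 = of_bool (\<alpha> \<in> asymmetric_bracelets (length \<alpha>))]"

text \<open>The bound on \<open>pc\<close> forces a halt exactly at 30, where the last annotation
  gives the output; the bound on the registers yields the word size.\<close>

definition run_invariant :: "bool list \<Rightarrow> config \<Rightarrow> bool" where
  "run_invariant \<alpha> s \<longleftrightarrow> pc s \<le> 30 \<and> mem s = mem (init_config \<alpha>) \<and>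
     (\<forall>i. reg s i \<le> 2 * length \<alpha>) \<and> (annotations \<alpha> ! pc s) (reg s)"

text \<open>
  The weight counts the comparisons left in both phases; after register 1 has absorbed
  register 2 at address 15, the latter must not be counted until it is reset at address 17.
\<close>

definition weight :: "bool list \<Rightarrow> config \<Rightarrow> nat" where
  "weight \<alpha> s =
     (if pc s \<in> {24, 25, 26} then 2 * length \<alpha>
      else 2 * length \<alpha> - (reg s 1 + (if pc s \<in> {16, 17} then 0 else reg s 2))
        + (if reg s 7 = 0 then 2 * length \<alpha> + 1 else 0))"

text \<open>Forward steps lower it through \<open>- pc s\<close>. The listed addresses lead to a
  backward jump and carry 40 extra, more than the jump costs. This is paid for on entry at 17, 20 or
  24, where \<open>weight\<close> drops by at least one; at 24 the \<open>+ 1\<close> in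
  \<open>weight\<close> ensures the drop.\<close>

definition potential :: "bool list \<Rightarrow> config \<Rightarrow> nat" where
  "potential \<alpha> s =
     40 * weight \<alpha> s + (if pc s \<in> {17, 18, 20, 24, 25, 26} then 80 else 40) - pc s"

section \<open>Preservation of the invariant and decrease of the potential\<close>

lemma length_bracelet_program [simp]: "length bracelet_program = 30"
  by (simp add: bracelet_program_def)

lemma mem_init_le: "mem (init_config \<alpha>) i \<le> 1"
  by (simp add: init_config_def)

lemma mem_init_nth: "i < length \<alpha> \<Longrightarrow> mem (init_config \<alpha>) i = of_bool (\<alpha> ! i)"
  by (simp add: init_config_def)

lemma run_invariant_init: "run_invariant \<alpha> (init_config \<alpha>)"
  by (simp add: run_invariant_def annotations_def init_config_def)

lemma run_invariant_step:
  assumes "\<alpha> \<noteq> []" "run_invariant \<alpha> s" "\<not> halted bracelet_program s"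
  shows "run_invariant \<alpha> (step bracelet_program s) \<and>
    potential \<alpha> (step bracelet_program s) < potential \<alpha> s"
proof -
  \<comment> \<open>This lets the constant 1 respect the register bound
    \<open>2 * length \<alpha>\<close>.\<close>
  have len: "Suc 0 \<le> length \<alpha>"
    using assms(1) by (simp add: Suc_le_eq)
  obtain p r M where s: "s = \<lparr>pc = p, reg = r, mem = M\<rparr>"
    by (cases s) auto
  have M: "M = mem (init_config \<alpha>)" and r: "\<forall>i. r i \<le> 2 * length \<alpha>"
    and ann: "(annotations \<alpha> ! p) r"
    using assms(2) by (auto simp: run_invariant_def s)
  have p: "p \<in> set [0..<30]"
    using assms(3) by (simp add: halted_def s)
  note defs = s M r len assms(1) run_invariant_def potential_def weight_def step_def halted_def
    bracelet_program_def annotations_def scanning_def comparing_def restarting_def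
  from p consider "p = 7" | "p = 8 \<or> p = 10" | "p = 11 \<or> p = 12" | "p = 13 \<or> p = 14"
    | "p = 15" | "p = 3 \<or> p = 21" | "p = 1 \<or> p = 26"
    | "p = 0 \<or> p = 2 \<or> p = 4 \<or> p = 5 \<or> p = 6 \<or> p = 9"
    | "p = 16 \<or> p = 17 \<or> p = 18 \<or> p = 19 \<or> p = 20 \<or> p = 22"
    | "p = 23 \<or> p = 24 \<or> p = 25 \<or> p = 27 \<or> p = 28 \<or> p = 29"
    by (auto simp: upt_rec)
  then show ?thesis
  proof cases
    case 1
    \<comment> \<open>Both \<open>j\<close> and \<open>k\<close> are below \<open>n\<close>, so a
      single subtraction computes the remainder of \<open>j + k\<close> modulo
      \<open>n\<close>.\<close>
    with ann show ?thesis by (auto simp: defs le_mod_geq)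
  next
    case 2
    \<comment> \<open>Position \<open>i\<close> of the reversal is position \<open>n - 1 - i\<close>
      of \<open>\<alpha>\<close>.\<close>
    with ann show ?thesis by (elim disjE) (auto simp: defs scanned_def nth_rotate rev_nth)
  next
    case 3
    with ann show ?thesis by (elim disjE) (auto simp: defs mem_init_nth)
  next
    case 4
    with ann show ?thesis
      by (elim disjE) (auto simp: defs agree_Suc dest: not_asymmetric_if_larger)
  next
    case 5
    with ann show ?thesis by (auto simp: defs verified_extend)
  next
    case 6
    with ann show ?thesis
      by (elim disjE) (auto simp: defs le_Suc_eq necklace_if_verified asymmetric_if_verified
          dest: not_asymmetric_if_equal necklace_if_period)
  next
    case 7
    with ann show ?thesis by (elim disjE) (auto simp: defs verified_def)
  next
    case 8
    with ann show ?thesis by (elim disjE) (auto simp: defs)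
  next
    case 9
    with ann show ?thesis by (elim disjE) (auto simp: defs)
  next
    case 10
    with ann show ?thesis by (elim disjE) (auto simp: defs)
  qed
qed

section \<open>Time, output, space and word size\<close>

lemma bracelet_program_invariant:
  "\<alpha> \<noteq> [] \<Longrightarrow> run_invariant \<alpha> (config_at bracelet_program \<alpha> t)"
  using config_at_invariant[of "run_invariant \<alpha>"] run_invariant_init run_invariant_step by blast

lemma bracelet_program_halted:
  assumes "\<alpha> \<noteq> []"
  shows "\<exists>t\<le>240 * length \<alpha>. halted bracelet_program (config_at bracelet_program \<alpha> t)"
proof -
  have "1 \<le> length \<alpha>"
    using assms by (simp add: Suc_le_eq)
  \<comment> \<open>The initial weight is \<open>4 * n + 1\<close>, so the potential is
    \<open>160 * n + 80\<close>.\<close>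
  then have "potential \<alpha> (init_config \<alpha>) \<le> 240 * length \<alpha>"
    by (simp add: potential_def weight_def init_config_def)
  with halted_at_potential[of "run_invariant \<alpha>" \<alpha> bracelet_program "potential \<alpha>"]
  show ?thesis
    using run_invariant_init run_invariant_step[OF assms] order_trans by metis
qed

lemma bracelet_program_run_time:
  assumes "\<alpha> \<noteq> []"
  shows "run_time bracelet_program \<alpha> \<le> 240 * length \<alpha>"
  unfolding run_time_def using bracelet_program_halted[OF assms] Least_le order_trans by metis

lemma bracelet_program_output:
  assumes "\<alpha> \<noteq> []"
  shows "run_output bracelet_program \<alpha> = of_bool (\<alpha> \<in> asymmetric_bracelets (length \<alpha>))"
proof -
  let ?s = "config_at bracelet_program \<alpha> (run_time bracelet_program \<alpha>)"
  have "halted bracelet_program ?s"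
    unfolding run_time_def using bracelet_program_halted[OF assms] by (metis (lifting) LeastI)
  then have "pc ?s = 30"
    using bracelet_program_invariant[OF assms]
    by (auto simp: halted_def run_invariant_def intro: antisym)
  then show ?thesis
    using bracelet_program_invariant[OF assms, of "run_time bracelet_program \<alpha>"]
    by (simp add: run_invariant_def annotations_def run_output_def)
qed

text \<open>Only the loads at 11 and 12 touch the memory, and the annotations there bound registers
  2 and 3.\<close>

lemma bracelet_program_addresses:
  assumes "\<alpha> \<noteq> []" "run_invariant \<alpha> s" "\<not> halted bracelet_program s"
  shows "instr_addresses (bracelet_program ! pc s) s \<subseteq> {..<length \<alpha>}"
proof -
  have "pc s \<in> set [0..<30]"
    using assms(3) by (simp add: halted_def)
  then consider "pc s = 11 \<or> pc s = 12"
    | "pc s \<in> {0, 1, 2, 3, 4, 5, 6, 7, 8, 9, 10, 13, 14, 15, 16, 17, 18, 19, 20}"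
    | "pc s \<in> {21, 22, 23, 24, 25, 26, 27, 28, 29}"
    by (auto simp: upt_rec)
  then show ?thesis
  proof cases
    case 1
    with assms(2) show ?thesis
      by (auto simp: run_invariant_def annotations_def bracelet_program_def comparing_def)
  qed (auto simp: bracelet_program_def)
qed

lemma bracelet_program_space:
  assumes "\<alpha> \<noteq> []"
  shows "run_space bracelet_program \<alpha> \<le> (card (registers bracelet_program) + 1) * length \<alpha>"
proof -
  have "accessed_addresses bracelet_program \<alpha> \<subseteq> {..<length \<alpha>}"
    unfolding accessed_addresses_def
  proof (rule UN_least)
    fix t assume "t \<in> {..<run_time bracelet_program \<alpha>}"
    then have "\<not> halted bracelet_program (config_at bracelet_program \<alpha> t)"
      unfolding run_time_def using not_less_Least by auto
    then show "instr_addresses (bracelet_program ! pc (config_at bracelet_program \<alpha> t))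
        (config_at bracelet_program \<alpha> t) \<subseteq> {..<length \<alpha>}"
      using bracelet_program_addresses bracelet_program_invariant assms by blast
  qed
  then have "Max (insert (length \<alpha>) (Suc ` accessed_addresses bracelet_program \<alpha>)) \<le> length \<alpha>"
    by (subst Max_le_iff) (auto intro: finite_subset)
  moreover have "card (registers bracelet_program) * 1 \<le> card (registers bracelet_program) * length \<alpha>"
    using assms by (intro mult_le_mono2) (simp add: Suc_le_eq)
  ultimately show ?thesis
    unfolding run_space_def by (simp only: distrib_right mult_1 mult_1_right add_mono)
qed

lemma bracelet_program_word_size: "logarithmic_word_size bracelet_program"
  unfolding logarithmic_word_size_def
proof (intro exI[of _ 2] allI impI)
  fix \<alpha> :: "bool list" and t i
  assume ne: "\<alpha> \<noteq> []"
  note inv = bracelet_program_invariant[OF ne, of t]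
  have "reg (config_at bracelet_program \<alpha> t) i \<le> 2 * length \<alpha>"
    using inv by (simp add: run_invariant_def)
  moreover have "mem (config_at bracelet_program \<alpha> t) i \<le> 1"
    using inv mem_init_le by (simp add: run_invariant_def)
  moreover have "(length \<alpha> + 1)\<^sup>2 = (length \<alpha>)\<^sup>2 + 2 * length \<alpha> + 1"
    by (simp add: power2_eq_square)
  ultimately show "reg (config_at bracelet_program \<alpha> t) i \<le> (length \<alpha> + 1)\<^sup>2 \<and>
      mem (config_at bracelet_program \<alpha> t) i \<le> (length \<alpha> + 1)\<^sup>2"
    by linarith
qed

theorem theorem1:
  "\<exists>P :: program.
     (\<forall>n\<ge>1. \<forall>\<alpha> :: bool list. length \<alpha> = n \<longrightarrow>
        halts P \<alpha> \<and> run_output P \<alpha> = (if \<alpha> \<in> asymmetric_bracelets n then 1 else 0)) \<and>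
     logarithmic_word_size P \<and>
     (\<lambda>n. real (worst_case (run_time P) n)) \<in> O(\<lambda>n. real n) \<and>
     (\<lambda>n. real (worst_case (run_space P) n)) \<in> O(\<lambda>n. real n)"
proof (intro exI[of _ bracelet_program] conjI allI impI)
  fix n :: nat and \<alpha> :: "bool list"
  assume "1 \<le> n" "length \<alpha> = n"
  then have "\<alpha> \<noteq> []"
    by auto
  then show "halts bracelet_program \<alpha>"
    unfolding halts_def using bracelet_program_halted by blast
  show "run_output bracelet_program \<alpha> = (if \<alpha> \<in> asymmetric_bracelets n then 1 else 0)"
    using bracelet_program_output[OF \<open>\<alpha> \<noteq> []\<close>] \<open>length \<alpha> = n\<close> by simp
qed (use bracelet_program_word_size worst_case_bigo bracelet_program_run_time
      bracelet_program_space in blast)+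

end
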